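(* Let $\mathfrak B$ be a generalized model (in the narrow sense) with universe $\beta X$. The following are equivalent: (i) $e(\mathfrak B)=\widetilde{\mathfrak A}$ for some ordinary model $\mathfrak A$ with universe $X$; (ii) $E(\mathfrak B)=\mathfrak A^*$ for some ordinary model $\mathfrak A$ with universe $X$; (iii) the interpretation in $\mathfrak B$ is pseudo-principal on functional symbols. Moreover, the model $\mathfrak A$ in (i) and (ii) is the same.
   Context: For a set $Z$, $\beta Z$ is the set of ultrafilters on $Z$, with $Z\subseteq\beta Z$ via principal ultrafilters and the standard compact Hausdorff topology with base $\{\mathfrak u:A\in\mathfrak u\}$; $(\forall^{\mathfrak u}z)\varphi(z)$ means $\{z:\varphi(z)\}\in\mathfrak u$. For $f:X^n\to X$: $\tilde f(\mathfrak u_1,\dots,\mathfrak u_n)=\{A:(\forall^{\mathfrak u_1}x_1)\cdots(\forall^{\mathfrak u_n}x_n)f(x_1,\dots,x_n)\in A\}$; for $Q\subseteq X^n$: $\tilde Q=\{(\mathfrak u_i):(\forall^{\mathfrak u_1}x_1)\cdots(\forall^{\mathfrak u_n}x_n)(x_1,\dots,x_n)\in Q\}$ and $Q^*=\{(\mathfrak u_i):\forall A_i\in\mathfrak u_i\ Q\cap(A_1\times\dots\times A_n)\ne\emptyset\}$. For an ordinary model $\mathfrak A=(X,F,\dots,R,\dots)$: $\widetilde{\mathfrak A}=(\beta X,\tilde F,\dots,\tilde R,\dots)$, $\mathfrak A^*=(\beta X,\tilde F,\dots,R^*,\dots)$. A generalized model in the narrow sense with universe $\beta X$ is an interpretation $\imath$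 sending each $n$-ary functional symbol to $\imath(F)\in\beta(X^{X^n})$ and each $n$-ary predicate symbol to $\imath(R)\in\beta\,\mathcal P(X^n)$. $\widetilde{\mathrm{app}}(\mathfrak u_1,\dots,\mathfrak u_n,\mathfrak f)=\{A:(\forall^{\mathfrak u_1}x_1)\cdots(\forall^{\mathfrak u_n}x_n)(\forall^{\mathfrak f}f)f(x_1,\dots,x_n)\in A\}$; $\mathfrak f$ is pseudo-principal if $\widetilde{\mathrm{app}}(a_1,\dots,a_n,\mathfrak f)\in X$ for all $a_i\in X$; the interpretation is pseudo-principal on functional symbols if each $\imath(F)$ is. Maps $e,E$: let $\mathrm{RC}_n$ be the maps $(\beta X)^n\to\beta X$ right continuous w.r.t. $X$ (for each $i$, with $a_1,\dots,a_{i-1}\in X$ and $\mathfrak u_{i+1},\dots,\mathfrak u_n\in\beta X$ fixed, continuous in the $i$-th argument) with the topology of pointwise convergence on $X^n$ (compact Hausdorff); $e=E$ on $\beta(X^{X^n})$ is the unique continuous extension of $f\mapsto\tilde f$. For relations, identify $Q$ with its characteristic function into discrete $\{0,1\}$ and define $e:\beta\,\mathcal P(X^n)\to\mathcal P((\beta X)^n)$ by the same construction (extension $Q\mapsto\tilde Q$). $E(\mathfrak r)=\{(\pi_1(\mathfrak q),\dots,\pi_n(\mathfrak q)):\mathfrak q\in e_1(\mathfrak r)\}$, where $e_1(\mathfrak r)\subseteq\beta(X^n)$ is obtained by the $e$-construction treating $\mathfrak r$ as an ultrafilter over unary relations on $X^n$, and $\pi_i(\mathfrak q)=\{A:\{x\in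 X^n:x_i\in A\}\in\mathfrak q\}$. For the generalized model $\mathfrak B$ with interpretation $\imath$: $e(\mathfrak B)=(\beta X,e(\imath(F)),\dots,e(\imath(R)),\dots)$ and $E(\mathfrak B)=(\beta X,E(\imath(F)),\dots,E(\imath(R)),\dots)$. *)

theory Defs
  imports "HOL-Analysis.Analysis" "HOL-Library.NList"
begin

section \<open>Ultrafilters and the space of ultrafilters on a set\<close>

text \<open>
  An ultrafilter on a set \<open>Z\<close> is represented by an ultrafilter (as a library filter) on the
  underlying type that contains \<open>Z\<close>; it corresponds to the collection
  \<open>{A. A \<subseteq> Z \<and> (\<forall>\<^sub>F z in \<uu>. z \<in> A)}\<close> of subsets of \<open>Z\<close> (lemma \<open>bij_betw_beta\<close>). The quantifier
  \<open>\<forall>\<^sub>F z in \<uu>. \<phi> z\<close> says that \<open>{z. \<phi> z} \<in> \<uu>\<close>.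
\<close>

definition ultra :: "'z filter \<Rightarrow> bool" where
  "ultra \<uu> \<longleftrightarrow> \<uu> \<noteq> bot \<and> (\<forall>P. (\<forall>\<^sub>F z in \<uu>. P z) \<or> (\<forall>\<^sub>F z in \<uu>. \<not> P z))"

definition beta :: "'z set \<Rightarrow> 'z filter set" where
  "beta Z = {\<uu>. ultra \<uu> \<and> (\<forall>\<^sub>F z in \<uu>. z \<in> Z)}"

definition pt :: "'z \<Rightarrow> 'z filter" where
  "pt z = principal {z}"

definition beta_topology :: "'z set \<Rightarrow> 'z filter topology" where
  "beta_topology Z = topology_generated_by {{\<uu> \<in> beta Z. \<forall>\<^sub>F z in \<uu>. z \<in> A} |A. A \<subseteq> Z}"

lemma topspace_beta_topology: "topspace (beta_topology Z) = beta Z"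
  by (auto simp: beta_topology_def beta_def)

lemma pt_in_beta: "z \<in> Z \<Longrightarrow> pt z \<in> beta Z"
  by (auto simp: pt_def beta_def ultra_def eventually_principal principal_eq_bot_iff)

definition set_ultrafilter_on :: "'z set \<Rightarrow> 'z set set \<Rightarrow> bool" where
  "set_ultrafilter_on Z U \<longleftrightarrow> U \<subseteq> Pow Z \<and> Z \<in> U \<and> {} \<notin> U \<and>
     (\<forall>A\<in>U. \<forall>B\<in>U. A \<inter> B \<in> U) \<and> (\<forall>A\<in>U. \<forall>B. A \<subseteq> B \<and> B \<subseteq> Z \<longrightarrow> B \<in> U) \<and>
     (\<forall>A\<subseteq>Z. A \<in> U \<or> Z - A \<in> U)"

lemma bij_betw_beta:
  "bij_betw (\<lambda>\<uu>. {A. A \<subseteq> Z \<and> (\<forall>\<^sub>F z in \<uu>. z \<in> A)}) (beta Z) {U. set_ultrafilter_on Z U}"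
  (is "bij_betw ?s _ _")
proof (rule bij_betwI')
  fix u v :: "'a filter" assume uv: "u \<in> beta Z" "v \<in> beta Z"
  have *: "(\<forall>\<^sub>F z in w. P z) \<longleftrightarrow> {z \<in> Z. P z} \<in> ?s w" if "w \<in> beta Z" for w and P :: "'a \<Rightarrow> bool"
    using that by (auto simp: beta_def eventually_conj_iff)
  show "(?s u = ?s v) = (u = v)"
  proof
    assume eq: "?s u = ?s v"
    show "u = v"
    proof (rule filter_eqI)
      fix P
      have "eventually P u \<longleftrightarrow> {z \<in> Z. P z} \<in> ?s u" by (rule *[OF uv(1)])
      also have "\<dots> \<longleftrightarrow> {z \<in> Z. P z} \<in> ?s v" by (subst eq) (rule refl)
      also have "\<dots> \<longleftrightarrow> eventually P v" by (rule *[OF uv(2), symmetric])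
      finally show "eventually P u = eventually P v" .
    qed
  qed simp
next
  fix u :: "'a filter" assume u: "u \<in> beta Z"
  have Z: "\<forall>\<^sub>F z in u. z \<in> Z" and ne: "u \<noteq> bot" using u by (auto simp: beta_def ultra_def)
  have 1: "A \<in> ?s u \<or> Z - A \<in> ?s u" if "A \<subseteq> Z" for A
    using u Z that by (auto simp: beta_def ultra_def eventually_conj_iff)
  have 2: "B \<in> ?s u" if "A \<in> ?s u" "A \<subseteq> B" "B \<subseteq> Z" for A B
    using that eventually_mono[of "\<lambda>z. z \<in> A" u "\<lambda>z. z \<in> B"] by blast
  have 3: "A \<inter> B \<in> ?s u" if "A \<in> ?s u" "B \<in> ?s u" for A B
    using that by (auto simp: eventually_conj_iff)
  have 4: "Z \<in> ?s u" "{} \<notin> ?s u" "?s u \<subseteq> Pow Z"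
    using Z ne by (auto simp: trivial_limit_def)
  show "?s u \<in> {U. set_ultrafilter_on Z U}"
    unfolding mem_Collect_eq set_ultrafilter_on_def
    by (intro conjI ballI allI impI) (use 1 2 3 4 in blast)+
next
  fix U assume "U \<in> {U. set_ultrafilter_on Z U}"
  then have U: "U \<subseteq> Pow Z" "Z \<in> U" "{} \<notin> U" "\<And>A B. A \<in> U \<Longrightarrow> B \<in> U \<Longrightarrow> A \<inter> B \<in> U"
    "\<And>A B. A \<in> U \<Longrightarrow> A \<subseteq> B \<Longrightarrow> B \<subseteq> Z \<Longrightarrow> B \<in> U" "\<And>A. A \<subseteq> Z \<Longrightarrow> A \<in> U \<or> Z - A \<in> U"
    by (auto simp: set_ultrafilter_on_def)
  define u where "u = Abs_filter (\<lambda>P. {z \<in> Z. P z} \<in> U)"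
  have ev: "eventually P u \<longleftrightarrow> {z \<in> Z. P z} \<in> U" for P
    unfolding u_def
  proof (rule eventually_Abs_filter, standard)
    show "{z \<in> Z. True} \<in> U" using U(2) by simp
    show "{z \<in> Z. P z \<and> Q z} \<in> U" if "{z \<in> Z. P z} \<in> U" "{z \<in> Z. Q z} \<in> U" for P Q
    proof -
      have "{z \<in> Z. P z \<and> Q z} = {z \<in> Z. P z} \<inter> {z \<in> Z. Q z}" by auto
      then show ?thesis using U(4)[OF that] by simp
    qed
    show "{z \<in> Z. Q z} \<in> U" if "\<forall>x. P x \<longrightarrow> Q x" "{z \<in> Z. P z} \<in> U" for P Q
      by (rule U(5)[OF that(2)]) (use that(1) in auto)
  qed
  have "Z - {z \<in> Z. P z} = {z \<in> Z. \<not> P z}" for P by auto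
  moreover have "{z \<in> Z. P z} \<in> U \<or> Z - {z \<in> Z. P z} \<in> U" for P
    by (rule U(6)) blast
  ultimately have "{z \<in> Z. P z} \<in> U \<or> {z \<in> Z. \<not> P z} \<in> U" for P
    by (simp only:)
  moreover have "eventually (\<lambda>z. z \<in> Z) u" "\<not> eventually (\<lambda>z. False) u"
    using U(2,3) by (simp_all add: ev)
  ultimately have "u \<in> beta Z"
    by (simp add: beta_def ultra_def ev trivial_limit_def)
  moreover have "U = ?s u"
  proof -
    have "{z \<in> Z. z \<in> A} = A" if "A \<subseteq> Z" for A using that by auto
    then show ?thesis using U(1) by (auto simp: ev)
  qed
  ultimately show "\<exists>x\<in>beta Z. U = ?s x" by blast
qed


section \<open>Ultrafilter extensions of functions and relations\<close>

text \<open>Tuples are lists: \<open>nlists n Z\<close> is \<open>Z\<^sup>n\<close>, and \<open>X\<^bsup>X\<^sup>n\<^esup>\<close> consists of extensional functions.\<close>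

abbreviation ops :: "nat \<Rightarrow> 'a set \<Rightarrow> ('a list \<Rightarrow> 'a) set" where
  "ops n X \<equiv> nlists n X \<rightarrow>\<^sub>E X"

text \<open>\<open>eventuallys [\<uu>\<^sub>1, \<dots>, \<uu>\<^sub>n] \<phi>\<close> is \<open>(\<forall>\<^sub>F x\<^sub>1 in \<uu>\<^sub>1. \<dots> \<forall>\<^sub>F x\<^sub>n in \<uu>\<^sub>n. \<phi> [x\<^sub>1, \<dots>, x\<^sub>n])\<close>.\<close>

primrec eventuallys :: "'a filter list \<Rightarrow> ('a list \<Rightarrow> bool) \<Rightarrow> bool" where
  "eventuallys [] \<phi> \<longleftrightarrow> \<phi> []"
| "eventuallys (\<uu> # us) \<phi> \<longleftrightarrow> (\<forall>\<^sub>F x in \<uu>. eventuallys us (\<lambda>xs. \<phi> (x # xs)))"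

definition fun_tilde :: "nat \<Rightarrow> 'a set \<Rightarrow> ('a list \<Rightarrow> 'a) \<Rightarrow> ('a filter list \<Rightarrow> 'a filter)" where
  "fun_tilde n X f = (\<lambda>us \<in> nlists n (beta X). Abs_filter (\<lambda>P. eventuallys us (\<lambda>xs. P (f xs))))"

definition rel_tilde :: "nat \<Rightarrow> 'a set \<Rightarrow> 'a list set \<Rightarrow> 'a filter list set" where
  "rel_tilde n X Q = {us \<in> nlists n (beta X). eventuallys us (\<lambda>xs. xs \<in> Q)}"

text \<open>\<open>listset [A\<^sub>1, \<dots>, A\<^sub>n]\<close> is the product \<open>A\<^sub>1 \<times> \<dots> \<times> A\<^sub>n\<close>.\<close>

definition rel_star :: "nat \<Rightarrow> 'a set \<Rightarrow> 'a list set \<Rightarrow> 'a filter list set" where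
  "rel_star n X Q = {us \<in> nlists n (beta X).
     \<forall>As. list_all2 (\<lambda>A \<uu>. A \<subseteq> X \<and> (\<forall>\<^sub>F x in \<uu>. x \<in> A)) As us \<longrightarrow> Q \<inter> listset As \<noteq> {}}"

definition app_tilde :: "'a filter list \<Rightarrow> ('a list \<Rightarrow> 'a) filter \<Rightarrow> 'a filter" where
  "app_tilde us \<ff> = Abs_filter (\<lambda>P. eventuallys us (\<lambda>xs. \<forall>\<^sub>F f in \<ff>. P (f xs)))"

lemma eventuallys_mono: "eventuallys us \<phi> \<Longrightarrow> (\<And>xs. \<phi> xs \<Longrightarrow> \<psi> xs) \<Longrightarrow> eventuallys us \<psi>"
proof (induction us arbitrary: \<phi> \<psi>)
  case (Cons u us)
  from Cons.prems(1) show ?case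
    by (auto elim!: eventually_mono intro: Cons.IH Cons.prems(2))
qed simp

lemma eventuallys_True: "eventuallys us (\<lambda>xs. True)"
  by (induction us) auto

lemma eventuallys_conj:
  "eventuallys us (\<lambda>xs. \<phi> xs \<and> \<psi> xs) \<longleftrightarrow> eventuallys us \<phi> \<and> eventuallys us \<psi>"
  by (induction us arbitrary: \<phi> \<psi>) (auto simp: eventually_conj_iff)

lemma eventually_fun_tilde:
  assumes "us \<in> nlists n (beta X)"
  shows "eventually P (fun_tilde n X f us) \<longleftrightarrow> eventuallys us (\<lambda>xs. P (f xs))"
proof -
  have "is_filter (\<lambda>P. eventuallys us (\<lambda>xs. P (f xs)))"
    by standard (auto simp: eventuallys_True eventuallys_conj elim: eventuallys_mono)
  with assms show ?thesis by (simp add: fun_tilde_def eventually_Abs_filter)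
qed

lemma eventually_app_tilde:
  "eventually P (app_tilde us \<ff>) \<longleftrightarrow> eventuallys us (\<lambda>xs. \<forall>\<^sub>F f in \<ff>. P (f xs))"
proof -
  have "is_filter (\<lambda>P. eventuallys us (\<lambda>xs. \<forall>\<^sub>F f in \<ff>. P (f xs)))"
    by standard
      (auto simp: eventuallys_True eventuallys_conj eventually_conj_iff
        elim!: eventuallys_mono eventually_mono)
  then show ?thesis by (simp add: app_tilde_def eventually_Abs_filter)
qed

definition pseudo_principal :: "nat \<Rightarrow> 'a set \<Rightarrow> ('a list \<Rightarrow> 'a) filter \<Rightarrow> bool" where
  "pseudo_principal n X \<ff> \<longleftrightarrow> (\<forall>as \<in> nlists n X. app_tilde (map pt as) \<ff> \<in> pt ` X)"


section \<open>Right continuous maps and the maps \<open>e\<close> and \<open>E\<close>\<close>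

definition RC :: "nat \<Rightarrow> 'a set \<Rightarrow> 'k topology \<Rightarrow> ('a filter list \<Rightarrow> 'k) set" where
  "RC n X K = {g \<in> nlists n (beta X) \<rightarrow>\<^sub>E topspace K.
     \<forall>as \<in> lists X. \<forall>us \<in> lists (beta X). length as + 1 + length us = n \<longrightarrow>
       continuous_map (beta_topology X) K (\<lambda>\<vv>. g (map pt as @ \<vv> # us))}"

text \<open>Pointwise convergence on \<open>X\<^sup>n\<close> only, not on all of its ultrafilter extension.\<close>

definition RC_topology :: "nat \<Rightarrow> 'a set \<Rightarrow> 'k topology \<Rightarrow> ('a filter list \<Rightarrow> 'k) topology" where
  "RC_topology n X K = pullback_topology (RC n X K) (\<lambda>g. \<lambda>as \<in> nlists n X. g (map pt as))
     (product_topology (\<lambda>_. K) (nlists n X))"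

definition beta_extension :: "'z set \<Rightarrow> 't topology \<Rightarrow> ('z \<Rightarrow> 't) \<Rightarrow> ('z filter \<Rightarrow> 't)" where
  "beta_extension Z T h = (THE g. g \<in> extensional (beta Z) \<and>
     continuous_map (beta_topology Z) T g \<and> (\<forall>z\<in>Z. g (pt z) = h z))"

definition e_fun :: "nat \<Rightarrow> 'a set \<Rightarrow> ('a list \<Rightarrow> 'a) filter \<Rightarrow> ('a filter list \<Rightarrow> 'a filter)" where
  "e_fun n X = beta_extension (ops n X) (RC_topology n X (beta_topology X)) (fun_tilde n X)"

text \<open>Relations are identified with characteristic functions into the discrete space \<open>bool\<close>.\<close>

definition e_rel :: "nat \<Rightarrow> 'a set \<Rightarrow> 'a list set filter \<Rightarrow> 'a filter list set" where
  "e_rel n X \<rr> = {us \<in> nlists n (beta X).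
     beta_extension (Pow (nlists n X)) (RC_topology n X (discrete_topology (UNIV :: bool set)))
       (\<lambda>Q. \<lambda>us \<in> nlists n (beta X). us \<in> rel_tilde n X Q) \<rr> us}"

definition E_fun :: "nat \<Rightarrow> 'a set \<Rightarrow> ('a list \<Rightarrow> 'a) filter \<Rightarrow> ('a filter list \<Rightarrow> 'a filter)" where
  "E_fun = e_fun"

text \<open>
  A subset \<open>Q\<close> of \<open>X\<^sup>n\<close> is the unary relation \<open>{[x] |x. x \<in> Q}\<close> on the set \<open>X\<^sup>n\<close>; hence the
  passage to singleton lists before applying the construction for arity 1 over \<open>X\<^sup>n\<close>.
\<close>

definition e1_rel :: "nat \<Rightarrow> 'a set \<Rightarrow> 'a list set filter \<Rightarrow> 'a list filter set" where
  "e1_rel n X \<rr> = {\<qq>. [\<qq>] \<in> e_rel 1 (nlists n X) (filtermap (\<lambda>Q. (\<lambda>x. [x]) ` Q) \<rr>)}"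

definition E_rel :: "nat \<Rightarrow> 'a set \<Rightarrow> 'a list set filter \<Rightarrow> 'a filter list set" where
  "E_rel n X \<rr> = {map (\<lambda>i. filtermap (\<lambda>xs. xs ! i) \<qq>) [0..<n] |\<qq>. \<qq> \<in> e1_rel n X \<rr>}"


section \<open>Ordinary and generalized models\<close>

record ('f, 'p) signature =
  fun_syms :: "'f set"
  fun_arity :: "'f \<Rightarrow> nat"
  rel_syms :: "'p set"
  rel_arity :: "'p \<Rightarrow> nat"

record ('f, 'p, 'u) model =
  universe :: "'u set"
  fun_of :: "'f \<Rightarrow> 'u list \<Rightarrow> 'u"
  rel_of :: "'p \<Rightarrow> 'u list set"

definition ordinary_model :: "('f, 'p) signature \<Rightarrow> 'u set \<Rightarrow> ('f, 'p, 'u) model \<Rightarrow> bool" where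
  "ordinary_model S X \<AA> \<longleftrightarrow> universe \<AA> = X \<and>
     fun_of \<AA> \<in> (\<Pi>\<^sub>E s\<in>fun_syms S. ops (fun_arity S s) X) \<and>
     rel_of \<AA> \<in> (\<Pi>\<^sub>E p\<in>rel_syms S. Pow (nlists (rel_arity S p) X))"

definition tilde_model ::
  "('f, 'p) signature \<Rightarrow> ('f, 'p, 'a) model \<Rightarrow> ('f, 'p, 'a filter) model" where
  "tilde_model S \<AA> = \<lparr>universe = beta (universe \<AA>),
     fun_of = (\<lambda>s\<in>fun_syms S. fun_tilde (fun_arity S s) (universe \<AA>) (fun_of \<AA> s)),
     rel_of = (\<lambda>p\<in>rel_syms S. rel_tilde (rel_arity S p) (universe \<AA>) (rel_of \<AA> p))\<rparr>"

definition star_model ::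
  "('f, 'p) signature \<Rightarrow> ('f, 'p, 'a) model \<Rightarrow> ('f, 'p, 'a filter) model" where
  "star_model S \<AA> = \<lparr>universe = beta (universe \<AA>),
     fun_of = (\<lambda>s\<in>fun_syms S. fun_tilde (fun_arity S s) (universe \<AA>) (fun_of \<AA> s)),
     rel_of = (\<lambda>p\<in>rel_syms S. rel_star (rel_arity S p) (universe \<AA>) (rel_of \<AA> p))\<rparr>"

text \<open>
  A generalized model (in the narrow sense) with universe \<open>beta X\<close>; it is recorded by its base
  set \<open>X\<close> and its interpretation.
\<close>

record ('f, 'p, 'a) gen_model =
  base :: "'a set"
  gfun_of :: "'f \<Rightarrow> ('a list \<Rightarrow> 'a) filter"
  grel_of :: "'p \<Rightarrow> 'a list set filter"

definition generalized_model :: "('f, 'p) signature \<Rightarrow> 'a set \<Rightarrow> ('f, 'p, 'a) gen_model \<Rightarrow> bool" where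
  "generalized_model S X \<BB> \<longleftrightarrow> base \<BB> = X \<and>
     gfun_of \<BB> \<in> (\<Pi>\<^sub>E s\<in>fun_syms S. beta (ops (fun_arity S s) X)) \<and>
     grel_of \<BB> \<in> (\<Pi>\<^sub>E p\<in>rel_syms S. beta (Pow (nlists (rel_arity S p) X)))"

definition e_model ::
  "('f, 'p) signature \<Rightarrow> ('f, 'p, 'a) gen_model \<Rightarrow> ('f, 'p, 'a filter) model" where
  "e_model S \<BB> = \<lparr>universe = beta (base \<BB>),
     fun_of = (\<lambda>s\<in>fun_syms S. e_fun (fun_arity S s) (base \<BB>) (gfun_of \<BB> s)),
     rel_of = (\<lambda>p\<in>rel_syms S. e_rel (rel_arity S p) (base \<BB>) (grel_of \<BB> p))\<rparr>"

definition E_model ::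
  "('f, 'p) signature \<Rightarrow> ('f, 'p, 'a) gen_model \<Rightarrow> ('f, 'p, 'a filter) model" where
  "E_model S \<BB> = \<lparr>universe = beta (base \<BB>),
     fun_of = (\<lambda>s\<in>fun_syms S. E_fun (fun_arity S s) (base \<BB>) (gfun_of \<BB> s)),
     rel_of = (\<lambda>p\<in>rel_syms S. E_rel (rel_arity S p) (base \<BB>) (grel_of \<BB> p))\<rparr>"

definition pseudo_principal_on_funs ::
  "('f, 'p) signature \<Rightarrow> ('f, 'p, 'a) gen_model \<Rightarrow> bool" where
  "pseudo_principal_on_funs S \<BB> \<longleftrightarrow>
     (\<forall>s\<in>fun_syms S. pseudo_principal (fun_arity S s) (base \<BB>) (gfun_of \<BB> s))"

end

theory Submission
  imports Defs
begin

text \<open>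
  The set \<open>pt ` Z\<close> is dense in \<open>beta Z\<close>, so a right continuous map is determined by its values on
  principal arguments, and the continuous extension defining \<open>e\<close> is the map that applies the
  ultrafilter quantifiers of the arguments first and the quantifier of the symbol last. For a
  relation symbol interpreted by \<open>\<rr>\<close> this makes \<open>e \<rr>\<close> the extension \<open>rel_tilde\<close>, and \<open>E \<rr>\<close> the
  extension \<open>rel_star\<close>, of the single relation \<open>{x. \<forall>\<^sub>F Q in \<rr>. x \<in> Q}\<close>, with no condition on \<open>\<rr>\<close>.
  For a function symbol interpreted by \<open>\<ff>\<close>, \<open>e \<ff>\<close> is of the form \<open>fun_tilde f\<close> iff its values at
  principal arguments are principal, and these values then define \<open>f\<close>.
\<close>

section \<open>Ultrafilters\<close>

lemma ultra_not_iff: "ultra \<uu> \<Longrightarrow> (\<forall>\<^sub>F z in \<uu>. \<not> P z) \<longleftrightarrow> \<not> (\<forall>\<^sub>F z in \<uu>. P z)"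
  using eventually_conj[of P \<uu> "\<lambda>z. \<not> P z"] by (auto simp: ultra_def)

text \<open>Along an ultrafilter \<open>P\<close> is eventually constant, so the quantifier commutes
  with every truth function, here membership in \<open>U\<close>. This yields continuity into the
  discrete space of truth values.\<close>

lemma ultra_eventually_mem_iff:
  assumes "ultra \<uu>"
  shows "(\<forall>\<^sub>F z in \<uu>. P z) \<in> U \<longleftrightarrow> (\<forall>\<^sub>F z in \<uu>. P z \<in> U)"
proof (cases "\<forall>\<^sub>F z in \<uu>. P z")
  case True
  then have "(\<forall>\<^sub>F z in \<uu>. P z \<in> U) \<longleftrightarrow> (\<forall>\<^sub>F z in \<uu>. True \<in> U)"
    by (intro eventually_cong) (auto elim: eventually_mono)
  with True assms show ?thesis by (cases "True \<in> U") (auto simp: ultra_def)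
next
  case False
  then have "\<forall>\<^sub>F z in \<uu>. \<not> P z" using ultra_not_iff[OF assms] by blast
  then have "(\<forall>\<^sub>F z in \<uu>. P z \<in> U) \<longleftrightarrow> (\<forall>\<^sub>F z in \<uu>. False \<in> U)"
    by (intro eventually_cong) (auto elim: eventually_mono)
  with False assms show ?thesis by (cases "False \<in> U") (auto simp: ultra_def)
qed

text \<open>Ultrafilters are minimal proper filters: if \<open>P\<close> held along \<open>F\<close>
  but not along \<open>\<uu>\<close>, its negation would hold along \<open>\<uu>\<close>, hence
  along the finer \<open>F\<close>.\<close>

lemma ultra_le_eq:
  assumes "ultra \<uu>" "F \<le> \<uu>" "F \<noteq> bot"
  shows "F = \<uu>"
proof (rule antisym[OF assms(2)], rule filter_leI)
  fix P assume P: "eventually P F"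
  show "eventually P \<uu>"
  proof (rule ccontr)
    assume "\<not> eventually P \<uu>"
    then have "eventually (\<lambda>x. \<not> P x) F"
      using assms(1,2) ultra_not_iff filter_leD by blast
    with P have "eventually (\<lambda>x. False) F" by eventually_elim simp
    with assms(3) show False by simp
  qed
qed

text \<open>Zorn's lemma on the proper filters below \<open>F\<close>, with the order reversed so
  that the maximal element is a minimal proper filter.\<close>

lemma exists_ultra_le:
  assumes "F \<noteq> bot"
  obtains \<uu> where "ultra \<uu>" "\<uu> \<le> F"
proof -
  define A where "A = {\<uu>. \<uu> \<noteq> bot \<and> \<uu> \<le> F}"
  have "\<exists>m\<in>A. \<forall>a\<in>A. a \<le> m \<longrightarrow> a = m"
  proof (rule predicate_Zorn)
    show "partial_order_on A (relation_of (\<lambda>x y. y \<le> x) A)"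
      by (rule partial_order_on_relation_ofI) auto
    fix C assume C: "C \<in> Chains (relation_of (\<lambda>x y. y \<le> x) A)"
    then have CA: "C \<subseteq> A" and tot: "\<And>x y. x \<in> C \<Longrightarrow> y \<in> C \<Longrightarrow> x \<le> y \<or> y \<le> x"
      by (auto simp: Chains_def relation_of_def)
    show "\<exists>u\<in>A. \<forall>a\<in>C. u \<le> a"
    proof (cases "C = {}")
      case True
      then show ?thesis using assms by (auto simp: A_def)
    next
      case False
      \<comment> \<open>The infimum of a nonempty chain is the union of its members as families of
        sets; the constantly false predicate then shows that it stays proper.\<close>
      have "eventually P (Inf C) \<longleftrightarrow> (\<exists>b\<in>C. eventually P b)" for P
        by (rule eventually_Inf_base[OF False]) (metis inf.absorb1 inf.absorb2 order_refl tot)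
      from this[of "\<lambda>_. False"] CA have "Inf C \<noteq> bot"
        by (auto simp: A_def eventually_False)
      moreover have "Inf C \<le> F"
        using False CA by (auto simp: A_def intro: Inf_lower2)
      ultimately show ?thesis
        by (intro bexI[of _ "Inf C"]) (auto simp: A_def intro: Inf_lower)
    qed
  qed
  then obtain m where m: "m \<noteq> bot" "m \<le> F" "\<And>a. a \<in> A \<Longrightarrow> a \<le> m \<Longrightarrow> a = m"
    by (auto simp: A_def)
  have "eventually P m \<or> eventually (\<lambda>x. \<not> P x) m" for P
  proof (rule disjCI)
    assume "\<not> eventually (\<lambda>x. \<not> P x) m"
    \<comment> \<open>Adding the set of \<open>P\<close> to \<open>m\<close> keeps it proper, so
      minimality returns \<open>m\<close> itself.\<close>
    then have "inf m (principal {x. P x}) \<noteq> bot"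
      by (simp add: trivial_limit_def eventually_inf_principal)
    then have "inf m (principal {x. P x}) = m"
      using m(2) by (intro m(3)) (auto simp: A_def intro: le_infI1)
    moreover have "eventually P (inf m (principal {x. P x}))"
      by (simp add: eventually_inf_principal)
    ultimately show "eventually P m" by simp
  qed
  with m(1,2) show ?thesis by (intro that[of m]) (auto simp: ultra_def)
qed

lemma ultra_filtermap: "ultra \<uu> \<Longrightarrow> ultra (filtermap f \<uu>)"
  by (auto simp: ultra_def eventually_filtermap filtermap_bot_iff)

lemma filtermap_in_beta:
  assumes "\<uu> \<in> beta Z" "\<And>z. z \<in> Z \<Longrightarrow> f z \<in> Y"
  shows "filtermap f \<uu> \<in> beta Y"
  using assms eventually_mono[of "\<lambda>z. z \<in> Z" \<uu> "\<lambda>z. f z \<in> Y"]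
  by (simp add: beta_def ultra_filtermap eventually_filtermap)

lemma eventually_pt [simp]: "eventually P (pt z) \<longleftrightarrow> P z"
  by (simp add: pt_def eventually_principal)

lemma pt_eq_iff [simp]: "pt x = pt y \<longleftrightarrow> x = y"
  by (simp add: pt_def)

lemma in_nlists_iff: "xs \<in> nlists n A \<longleftrightarrow> length xs = n \<and> set xs \<subseteq> A"
  unfolding nlists_def by (rule mem_Collect_eq)

text \<open>As simp rules these loop together with \<open>in_nlists_iff\<close>.\<close>
declare nlistsE_length [simp del] nlistsE_set [simp del]

section \<open>Iterated ultrafilter quantifiers\<close>

lemma map_pt_in_nlists: "as \<in> nlists n X \<Longrightarrow> map pt as \<in> nlists n (beta X)"
  by (auto simp: in_nlists_iff pt_in_beta)

lemma eventuallys_pt_append: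
  "eventuallys (map pt as @ us) \<phi> \<longleftrightarrow> eventuallys us (\<lambda>xs. \<phi> (as @ xs))"
  by (induction as arbitrary: \<phi>) simp_all

lemma eventuallys_pt [simp]: "eventuallys (map pt as) \<phi> \<longleftrightarrow> \<phi> as"
  using eventuallys_pt_append[of as "[]"] by simp

lemma eventuallys_not:
  "us \<in> nlists n (beta X) \<Longrightarrow> eventuallys us (\<lambda>xs. \<not> \<phi> xs) \<longleftrightarrow> \<not> eventuallys us \<phi>"
proof (induction us arbitrary: n \<phi>)
  case (Cons u us)
  then obtain m where "ultra u" "us \<in> nlists m (beta X)"
    by (auto simp: beta_def elim: nlists_Cons_Suc)
  then show ?case by (simp add: Cons.IH ultra_not_iff)
qed simp

lemma eventuallys_in_nlists:
  "us \<in> nlists n (beta X) \<Longrightarrow> eventuallys us (\<lambda>xs. xs \<in> nlists n X)"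
proof (induction us arbitrary: n)
  case (Cons u us)
  then obtain m where m: "n = Suc m" "u \<in> beta X" "us \<in> nlists m (beta X)"
    by (auto elim: nlists_Cons_Suc)
  from m(2) have "\<forall>\<^sub>F x in u. x \<in> X" by (simp add: beta_def)
  then show ?case
    by (rule eventually_mono[THEN iffD2[OF eventuallys.simps(2)]])
      (use m(3) in \<open>simp add: m(1) eventuallys_conj eventuallys_True Cons.IH\<close>)
qed (simp add: in_nlists_iff)

text \<open>Almost every tuple lies in \<open>nlists n X\<close>, so this membership can be
  conjoined to either formula without changing its truth value.\<close>

lemma eventuallys_cong_nlists:
  assumes "us \<in> nlists n (beta X)" "\<And>xs. xs \<in> nlists n X \<Longrightarrow> \<phi> xs \<longleftrightarrow> \<psi> xs"
  shows "eventuallys us \<phi> \<longleftrightarrow> eventuallys us \<psi>"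
proof -
  have "eventuallys us \<phi> \<longleftrightarrow> eventuallys us (\<lambda>xs. \<phi> xs \<and> xs \<in> nlists n X)"
    using assms(1) by (simp add: eventuallys_conj eventuallys_in_nlists)
  also have "(\<lambda>xs. \<phi> xs \<and> xs \<in> nlists n X) = (\<lambda>xs. \<psi> xs \<and> xs \<in> nlists n X)"
    using assms(2) by blast
  also have "eventuallys us \<dots> \<longleftrightarrow> eventuallys us \<psi>"
    using assms(1) by (simp add: eventuallys_conj eventuallys_in_nlists)
  finally show ?thesis .
qed

section \<open>Topology of \<open>beta Z\<close> and continuous extensions\<close>

lemma openin_beta_eventually:
  "openin (beta_topology Z) {\<uu> \<in> beta Z. \<forall>\<^sub>F z in \<uu>. P z}"
proof -
  have "{\<uu> \<in> beta Z. \<forall>\<^sub>F z in \<uu>. P z} = {\<uu> \<in> beta Z. \<forall>\<^sub>F z in \<uu>. z \<in> {z \<in> Z. P z}}"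
    by (auto simp: beta_def eventually_conj_iff)
  then show ?thesis
    unfolding beta_topology_def by (intro topology_generated_by_Basis) blast
qed

text \<open>Sets given by one predicate are closed under finite intersections, so the generating
  family acts as a base.\<close>

lemma openin_beta_basic:
  assumes "openin (beta_topology Z) W" "\<uu> \<in> W"
  obtains P where "eventually P \<uu>" "\<And>\<vv>. \<vv> \<in> beta Z \<Longrightarrow> eventually P \<vv> \<Longrightarrow> \<vv> \<in> W"
proof -
  have "generate_topology_on {{\<uu> \<in> beta Z. \<forall>\<^sub>F z in \<uu>. z \<in> A} |A. A \<subseteq> Z} W"
    using assms(1) by (simp add: beta_topology_def openin_topology_generated_by_iff)
  then have "\<exists>P. eventually P \<uu> \<and> (\<forall>\<vv>\<in>beta Z. eventually P \<vv> \<longrightarrow> \<vv> \<in> W)"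
    using assms(2)
  proof induction
    case (Int a b)
    then obtain P Q where
      "eventually P \<uu>" "\<forall>\<vv>\<in>beta Z. eventually P \<vv> \<longrightarrow> \<vv> \<in> a"
      "eventually Q \<uu>" "\<forall>\<vv>\<in>beta Z. eventually Q \<vv> \<longrightarrow> \<vv> \<in> b" by blast
    then show ?case
      by (intro exI[of _ "\<lambda>z. P z \<and> Q z"]) (simp add: eventually_conj_iff)
  qed blast+
  then show ?thesis using that by blast
qed

text \<open>Distinct ultrafilters disagree on some predicate, and a predicate and its negation
  define disjoint open sets.\<close>

lemma Hausdorff_space_beta: "Hausdorff_space (beta_topology Z)"
  unfolding Hausdorff_space_def topspace_beta_topology
proof (intro allI impI, elim conjE)
  fix u v assume uv: "u \<in> beta Z" "v \<in> beta Z" "u \<noteq> v"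
  then have ultra: "ultra u" "ultra v" by (auto simp: beta_def)
  from uv(3) obtain P where P: "eventually P u \<noteq> eventually P v"
    by (auto simp: filter_eq_iff)
  obtain Q where Q: "eventually Q u" "\<forall>\<^sub>F z in v. \<not> Q z"
  proof (cases "eventually P u")
    case True
    with P that[of P] ultra_not_iff[OF ultra(2), of P] show ?thesis by blast
  next
    case False
    with P that[of "\<lambda>z. \<not> P z"] ultra_not_iff[OF ultra(1), of P] show ?thesis by simp
  qed
  have "disjnt {\<uu> \<in> beta Z. \<forall>\<^sub>F z in \<uu>. Q z} {\<uu> \<in> beta Z. \<forall>\<^sub>F z in \<uu>. \<not> Q z}"
    by (auto simp: disjnt_def beta_def ultra_not_iff)
  with uv Q show "\<exists>U V. openin (beta_topology Z) U \<and> openin (beta_topology Z) V \<and>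
      u \<in> U \<and> v \<in> V \<and> disjnt U V"
    by (intro exI[of _ "{\<uu> \<in> beta Z. \<forall>\<^sub>F z in \<uu>. Q z}"] exI[of _ "{\<uu> \<in> beta Z. \<forall>\<^sub>F z in \<uu>. \<not> Q z}"])
      (simp add: openin_beta_eventually)
qed

lemma continuous_map_beta_eqI:
  assumes g: "continuous_map (beta_topology Z) K g" and h: "continuous_map (beta_topology Z) K h"
    and K: "Hausdorff_space K" and eq: "\<And>z. z \<in> Z \<Longrightarrow> g (pt z) = h (pt z)"
    and \<vv>: "\<vv> \<in> beta Z"
  shows "g \<vv> = h \<vv>"
proof (rule ccontr)
  assume ne: "g \<vv> \<noteq> h \<vv>"
  have "g \<vv> \<in> topspace K" "h \<vv> \<in> topspace K"
    using continuous_map_image_subset_topspace[OF g] continuous_map_image_subset_topspace[OF h] \<vv>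
    by (auto simp: topspace_beta_topology)
  with ne K obtain U V where UV: "openin K U" "openin K V" "g \<vv> \<in> U" "h \<vv> \<in> V" "disjnt U V"
    unfolding Hausdorff_space_def by blast
  \<comment> \<open>On this neighbourhood of \<open>\<vv>\<close> the maps take values in disjoint
    open sets; by density it contains a principal ultrafilter, where \<open>eq\<close> is
    contradicted.\<close>
  define W where "W = {\<uu> \<in> beta Z. g \<uu> \<in> U} \<inter> {\<uu> \<in> beta Z. h \<uu> \<in> V}"
  have "openin (beta_topology Z) W"
    unfolding W_def
    using openin_continuous_map_preimage[OF g UV(1)] openin_continuous_map_preimage[OF h UV(2)]
    by (intro openin_Int) (simp_all add: topspace_beta_topology)
  moreover have "\<vv> \<in> W" using UV \<vv> by (simp add: W_def)
  ultimately obtain P where P: "eventually P \<vv>"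
      "\<And>\<uu>. \<uu> \<in> beta Z \<Longrightarrow> eventually P \<uu> \<Longrightarrow> \<uu> \<in> W"
    by (rule openin_beta_basic) blast
  have "\<forall>\<^sub>F z in \<vv>. z \<in> Z" and "\<vv> \<noteq> bot" using \<vv> by (auto simp: beta_def ultra_def)
  with P(1) have "\<exists>z. P z \<and> z \<in> Z"
    by (intro eventually_happens') (auto simp: eventually_conj_iff)
  then obtain z where "z \<in> Z" "pt z \<in> W" using P(2) pt_in_beta by fastforce
  with eq UV(5) show False by (auto simp: W_def disjnt_def)
qed

text \<open>\<open>D\<close> pulls predicates back along \<open>f\<close>: the preimage of the basic
  open set given by \<open>P\<close> is the one given by \<open>D P\<close>.\<close>

lemma continuous_map_into_beta:
  assumes "\<And>\<uu>. \<uu> \<in> beta Z \<Longrightarrow> f \<uu> \<in> beta Y"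
    and "\<And>P \<uu>. \<uu> \<in> beta Z \<Longrightarrow> eventually P (f \<uu>) \<longleftrightarrow> eventually (D P) \<uu>"
  shows "continuous_map (beta_topology Z) (beta_topology Y) f"
  unfolding beta_topology_def[of Y] continuous_on_generated_topo_iff topspace_beta_topology
proof (intro conjI allI impI)
  fix U assume "U \<in> {{\<uu> \<in> beta Y. \<forall>\<^sub>F z in \<uu>. z \<in> A} |A. A \<subseteq> Y}"
  then obtain A where U: "U = {\<uu> \<in> beta Y. \<forall>\<^sub>F z in \<uu>. z \<in> A}" by blast
  have "f -` U \<inter> beta Z = {\<uu> \<in> beta Z. eventually (D (\<lambda>z. z \<in> A)) \<uu>}"
    using assms by (auto simp: U)
  then show "openin (beta_topology Z) (f -` U \<inter> beta Z)"
    by (simp add: openin_beta_eventually)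
next
  have "{\<uu> \<in> beta Y. \<forall>\<^sub>F z in \<uu>. z \<in> Y} = beta Y" by (auto simp: beta_def)
  then have "beta Y \<in> {{\<uu> \<in> beta Y. \<forall>\<^sub>F z in \<uu>. z \<in> A} |A. A \<subseteq> Y}" by blast
  with assms(1) show "f ` beta Z \<subseteq> \<Union>{{\<uu> \<in> beta Y. \<forall>\<^sub>F z in \<uu>. z \<in> A} |A. A \<subseteq> Y}" by blast
qed

lemma continuous_map_into_bool:
  assumes "\<And>\<uu>. \<uu> \<in> beta Z \<Longrightarrow> f \<uu> \<longleftrightarrow> eventually P \<uu>"
  shows "continuous_map (beta_topology Z) (discrete_topology UNIV) f"
  unfolding continuous_map_def
proof (intro conjI allI impI)
  fix U :: "bool set"
  have "f \<uu> \<in> U \<longleftrightarrow> (\<forall>\<^sub>F z in \<uu>. P z \<in> U)" if "\<uu> \<in> beta Z" for \<uu>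
    using that assms[OF that] ultra_eventually_mem_iff[of \<uu> P U] by (simp add: beta_def)
  then have "{\<uu> \<in> topspace (beta_topology Z). f \<uu> \<in> U} = {\<uu> \<in> beta Z. \<forall>\<^sub>F z in \<uu>. P z \<in> U}"
    by (auto simp: topspace_beta_topology)
  then show "openin (beta_topology Z) {\<uu> \<in> topspace (beta_topology Z). f \<uu> \<in> U}"
    by (simp add: openin_beta_eventually)
qed simp

section \<open>Uniqueness of right continuous maps and of continuous extensions into their
  space\<close>

lemma RC_eqI:
  assumes g: "g \<in> RC n X K" and h: "h \<in> RC n X K" and K: "Hausdorff_space K"
    and eq: "\<And>as. as \<in> nlists n X \<Longrightarrow> g (map pt as) = h (map pt as)"
  shows "g = h"
proof -
  \<comment> \<open>The arguments are split into a principal prefix and an arbitrary tail. The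
    induction shortens the tail, and the prefix is left general so that it can absorb the head of
    the tail.\<close>
  have *: "g (map pt as @ us) = h (map pt as @ us)"
    if "as \<in> lists X" "us \<in> lists (beta X)" "length as + length us = n" for as us
    using that
  proof (induction us arbitrary: as)
    case Nil
    then show ?case using eq[of as] by (auto simp: in_nlists_iff)
  next
    case (Cons v us)
    have cont: "continuous_map (beta_topology X) K (\<lambda>\<vv>. k (map pt as @ \<vv> # us))"
      if "k \<in> RC n X K" for k
      using that Cons.prems by (auto simp: RC_def)
    \<comment> \<open>Right continuity applies to the head since everything before it is principal;
      at principal heads the induction hypothesis holds with a prefix longer by one.\<close>
    show ?case
    proof (rule continuous_map_beta_eqI[OF cont[OF g] cont[OF h] K])
      fix x assume "x \<in> X"
      with Cons.prems show "g (map pt as @ pt x # us) = h (map pt as @ pt x # us)"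
        using Cons.IH[of "as @ [x]"] by simp
    next
      show "v \<in> beta X" using Cons.prems by simp
    qed
  qed
  show ?thesis
  proof (rule PiE_ext)
    show "g \<in> nlists n (beta X) \<rightarrow>\<^sub>E topspace K" "h \<in> nlists n (beta X) \<rightarrow>\<^sub>E topspace K"
      using g h by (auto simp: RC_def)
    show "g us = h us" if "us \<in> nlists n (beta X)" for us
      using *[of "[]" us] that by (auto simp: in_nlists_iff)
  qed
qed

text \<open>Pointwise convergence on \<open>nlists n X\<close> makes continuity of
  \<open>\<Phi>\<close> a matter of single principal tuples. A rival extension agrees with
  \<open>\<Phi>\<close> at each such tuple by density in the symbol argument, and then everywhere by
  \<open>RC_eqI\<close>.\<close>

lemma beta_extension_RC_eq:
  assumes K: "Hausdorff_space K"
    and RC: "\<And>\<ff>. \<ff> \<in> beta Z \<Longrightarrow> \<Phi> \<ff> \<in> RC n X K"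
    and cont: "\<And>as. as \<in> nlists n X \<Longrightarrow> continuous_map (beta_topology Z) K (\<lambda>\<ff>. \<Phi> \<ff> (map pt as))"
    and ext: "\<And>z. z \<in> Z \<Longrightarrow> \<Phi> (pt z) = h z"
    and \<ff>: "\<ff> \<in> beta Z"
  shows "beta_extension Z (RC_topology n X K) h \<ff> = \<Phi> \<ff>"
proof -
  let ?T = "RC_topology n X K"
  let ?ev = "\<lambda>g. \<lambda>as \<in> nlists n X. g (map pt as)"
  have "continuous_map (beta_topology Z) ?T \<Phi>"
    unfolding RC_topology_def
  proof (rule continuous_map_pullback')
    show "continuous_map (beta_topology Z) (product_topology (\<lambda>_. K) (nlists n X)) (?ev \<circ> \<Phi>)"
      using cont by (auto simp: continuous_map_componentwise comp_def)
    show "topspace (beta_topology Z) \<subseteq> \<Phi> -` RC n X K"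
      using RC by (auto simp: topspace_beta_topology)
  qed
  then have 1: "continuous_map (beta_topology Z) ?T (restrict \<Phi> (beta Z))"
    by (rule continuous_map_eq) (simp add: topspace_beta_topology)
  have 2: "restrict \<Phi> (beta Z) (pt z) = h z" if "z \<in> Z" for z
    using that ext by (simp add: pt_in_beta)
  have "beta_extension Z ?T h = restrict \<Phi> (beta Z)"
    unfolding beta_extension_def
  proof (rule the_equality)
    show "restrict \<Phi> (beta Z) \<in> extensional (beta Z) \<and>
      continuous_map (beta_topology Z) ?T (restrict \<Phi> (beta Z)) \<and>
      (\<forall>z\<in>Z. restrict \<Phi> (beta Z) (pt z) = h z)"
      using 1 2 by simp
  next
    fix g assume g: "g \<in> extensional (beta Z) \<and> continuous_map (beta_topology Z) ?T g \<and>
      (\<forall>z\<in>Z. g (pt z) = h z)"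
    show "g = restrict \<Phi> (beta Z)"
    proof (rule extensionalityI[of _ "beta Z"])
      fix \<uu> assume \<uu>: "\<uu> \<in> beta Z"
      have gRC: "g \<uu> \<in> RC n X K"
        using g \<uu> continuous_map_image_subset_topspace[of "beta_topology Z" ?T g]
        by (auto simp: RC_topology_def topspace_pullback_topology topspace_beta_topology)
      \<comment> \<open>Evaluation at a principal tuple is a coordinate projection of the product
        from which the topology is pulled back.\<close>
      have ev: "continuous_map ?T K (\<lambda>k. k (map pt as))" if as: "as \<in> nlists n X" for as
      proof -
        have "continuous_map ?T K ((\<lambda>y. y as) \<circ> ?ev)"
          unfolding RC_topology_def
          by (intro continuous_map_pullback continuous_map_product_projection as)
        with as show ?thesis by (simp add: comp_def)
      qed
      have "g \<uu> (map pt as) = \<Phi> \<uu> (map pt as)" if as: "as \<in> nlists n X" for as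
      proof (rule continuous_map_beta_eqI[OF _ cont[OF as] K _ \<uu>])
        show "continuous_map (beta_topology Z) K (\<lambda>\<uu>. g \<uu> (map pt as))"
          using continuous_map_compose[OF _ ev[OF as]] g by (auto simp: comp_def)
        show "g (pt z) (map pt as) = \<Phi> (pt z) (map pt as)" if "z \<in> Z" for z
          using g that ext by simp
      qed
      then have "g \<uu> = \<Phi> \<uu>" by (rule RC_eqI[OF gRC RC[OF \<uu>] K])
      with \<uu> show "g \<uu> = restrict \<Phi> (beta Z) \<uu>" by simp
    qed (use g in auto)
  qed
  with \<ff> show ?thesis by simp
qed

section \<open>The maps \<open>e\<close> and \<open>E\<close>\<close>

lemma app_tilde_in_beta:
  assumes "\<ff> \<in> beta (ops n X)" "us \<in> nlists n (beta X)"
  shows "app_tilde us \<ff> \<in> beta X"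
proof -
  have \<ff>: "ultra \<ff>" "\<forall>\<^sub>F f in \<ff>. f \<in> ops n X" using assms(1) by (auto simp: beta_def)
  have neg: "(\<forall>\<^sub>F x in app_tilde us \<ff>. \<not> P x) \<longleftrightarrow> \<not> (\<forall>\<^sub>F x in app_tilde us \<ff>. P x)" for P
    using assms(2) \<ff>(1) by (simp add: eventually_app_tilde ultra_not_iff eventuallys_not)
  \<comment> \<open>The negation law at the constantly true predicate says that falsity does not
    hold eventually.\<close>
  have "app_tilde us \<ff> \<noteq> bot" using neg[of "\<lambda>_. True"] by (simp add: trivial_limit_def)
  then have "ultra (app_tilde us \<ff>)" unfolding ultra_def using neg by blast
  moreover have "\<forall>\<^sub>F x in app_tilde us \<ff>. x \<in> X"
    unfolding eventually_app_tilde
    by (rule eventuallys_mono[OF eventuallys_in_nlists[OF assms(2)]])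
      (rule eventually_mono[OF \<ff>(2)], auto)
  ultimately show ?thesis by (simp add: beta_def)
qed

text \<open>The candidate extension is \<open>app_tilde\<close>: with a principal prefix it depends
  on the next argument through a single predicate, hence continuously, and at \<open>pt f\<close>
  the innermost quantifier is evaluation at \<open>f\<close>.\<close>

lemma e_fun_eq:
  assumes "\<ff> \<in> beta (ops n X)"
  shows "e_fun n X \<ff> = (\<lambda>us \<in> nlists n (beta X). app_tilde us \<ff>)"
  unfolding e_fun_def
proof (rule beta_extension_RC_eq[where \<Phi> = "\<lambda>\<ff>. \<lambda>us \<in> nlists n (beta X). app_tilde us \<ff>"])
  fix \<ff> :: "('a list \<Rightarrow> 'a) filter" assume \<ff>: "\<ff> \<in> beta (ops n X)"
  let ?g = "\<lambda>us \<in> nlists n (beta X). app_tilde us \<ff>"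
  have "continuous_map (beta_topology X) (beta_topology X) (\<lambda>\<vv>. ?g (map pt as @ \<vv> # us))"
    if "as \<in> lists X" "us \<in> lists (beta X)" "length as + 1 + length us = n" for as us
  proof (rule continuous_map_into_beta[where
        D = "\<lambda>P x. eventuallys us (\<lambda>xs. \<forall>\<^sub>F f in \<ff>. P (f (as @ x # xs)))"])
    fix \<vv> assume "\<vv> \<in> beta X"
    with that have *: "map pt as @ \<vv> # us \<in> nlists n (beta X)"
      by (auto simp: in_nlists_iff pt_in_beta)
    with \<ff> show "?g (map pt as @ \<vv> # us) \<in> beta X" by (simp add: app_tilde_in_beta)
    show "eventually P (?g (map pt as @ \<vv> # us)) \<longleftrightarrow>
        (\<forall>\<^sub>F x in \<vv>. eventuallys us (\<lambda>xs. \<forall>\<^sub>F f in \<ff>. P (f (as @ x # xs))))" for P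
      using * by (simp add: eventually_app_tilde eventuallys_pt_append)
  qed
  with \<ff> show "?g \<in> RC n X (beta_topology X)"
    by (auto simp: RC_def topspace_beta_topology app_tilde_in_beta)
next
  fix as assume as: "as \<in> nlists n X"
  show "continuous_map (beta_topology (ops n X)) (beta_topology X)
      (\<lambda>\<ff>. (\<lambda>us \<in> nlists n (beta X). app_tilde us \<ff>) (map pt as))"
    by (rule continuous_map_into_beta[where D = "\<lambda>P f. P (f as)"])
      (use map_pt_in_nlists[OF as] in \<open>simp_all add: app_tilde_in_beta eventually_app_tilde\<close>)
next
  fix f :: "'a list \<Rightarrow> 'a"
  show "(\<lambda>us \<in> nlists n (beta X). app_tilde us (pt f)) = fun_tilde n X f"
    by (simp add: fun_tilde_def app_tilde_def)
qed (use assms Hausdorff_space_beta in auto)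

section \<open>Relation symbols and their limit relations\<close>

text \<open>The pointwise limit of characteristic functions along \<open>\<rr>\<close>; for an
  ultrafilter it always exists, as the two-point discrete space is compact.\<close>

definition limit_rel :: "nat \<Rightarrow> 'a set \<Rightarrow> 'a list set filter \<Rightarrow> 'a list set" where
  "limit_rel n X \<rr> = {xs \<in> nlists n X. \<forall>\<^sub>F Q in \<rr>. xs \<in> Q}"

lemma e_rel_eq:
  assumes "\<rr> \<in> beta (Pow (nlists n X))"
  shows "e_rel n X \<rr> = rel_tilde n X (limit_rel n X \<rr>)"
proof -
  let ?\<Phi> = "\<lambda>\<rr>. \<lambda>us \<in> nlists n (beta X). eventuallys us (\<lambda>xs. \<forall>\<^sub>F Q in \<rr>. xs \<in> Q)"
  have "beta_extension (Pow (nlists n X)) (RC_topology n X (discrete_topology (UNIV :: bool set)))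
      (\<lambda>Q. \<lambda>us \<in> nlists n (beta X). us \<in> rel_tilde n X Q) \<rr> = ?\<Phi> \<rr>"
  proof (rule beta_extension_RC_eq[where \<Phi> = ?\<Phi>])
    fix \<rr> :: "'a list set filter"
    have "continuous_map (beta_topology X) (discrete_topology UNIV) (\<lambda>\<vv>. ?\<Phi> \<rr> (map pt as @ \<vv> # us))"
      if "as \<in> lists X" "us \<in> lists (beta X)" "length as + 1 + length us = n" for as us
    proof (rule continuous_map_into_bool[where
          P = "\<lambda>x. eventuallys us (\<lambda>xs. \<forall>\<^sub>F Q in \<rr>. as @ x # xs \<in> Q)"])
      fix \<vv> assume "\<vv> \<in> beta X"
      with that have "map pt as @ \<vv> # us \<in> nlists n (beta X)"
        by (auto simp: in_nlists_iff pt_in_beta)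
      then show "?\<Phi> \<rr> (map pt as @ \<vv> # us) \<longleftrightarrow>
          (\<forall>\<^sub>F x in \<vv>. eventuallys us (\<lambda>xs. \<forall>\<^sub>F Q in \<rr>. as @ x # xs \<in> Q))"
        by (simp add: eventuallys_pt_append)
    qed
    then show "?\<Phi> \<rr> \<in> RC n X (discrete_topology UNIV)"
      by (auto simp: RC_def)
  next
    fix as assume as: "as \<in> nlists n X"
    show "continuous_map (beta_topology (Pow (nlists n X))) (discrete_topology UNIV)
        (\<lambda>\<rr>. ?\<Phi> \<rr> (map pt as))"
      by (rule continuous_map_into_bool[where P = "\<lambda>Q. as \<in> Q"])
        (use map_pt_in_nlists[OF as] in simp)
  qed (use assms in \<open>auto simp: rel_tilde_def\<close>)
  then have "e_rel n X \<rr> = {us \<in> nlists n (beta X). eventuallys us (\<lambda>xs. \<forall>\<^sub>F Q in \<rr>. xs \<in> Q)}"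
    by (auto simp: e_rel_def)
  also have "\<dots> = rel_tilde n X (limit_rel n X \<rr>)"
    unfolding rel_tilde_def limit_rel_def
    by (intro Collect_cong conj_cong refl eventuallys_cong_nlists) auto
  finally show ?thesis .
qed

text \<open>Passing to singleton lists commutes with taking the limit relation, so
  \<open>e_rel_eq\<close> for arity 1 over \<open>nlists n X\<close> applies.\<close>

lemma e1_rel_eq:
  assumes "\<rr> \<in> beta (Pow (nlists n X))"
  shows "e1_rel n X \<rr> = {\<qq> \<in> beta (nlists n X). \<forall>\<^sub>F xs in \<qq>. xs \<in> limit_rel n X \<rr>}"
proof -
  have "filtermap (\<lambda>Q. (\<lambda>x. [x]) ` Q) \<rr> \<in> beta (Pow (nlists 1 (nlists n X)))"
    by (rule filtermap_in_beta[OF assms]) (auto simp: in_nlists_iff)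
  then show ?thesis
    by (auto simp: e1_rel_def e_rel_eq rel_tilde_def limit_rel_def eventually_filtermap
        in_nlists_iff image_iff)
qed

lemma in_listset_iff: "xs \<in> listset As \<longleftrightarrow> list_all2 (\<in>) xs As"
  by (induction As arbitrary: xs) (auto simp: set_Cons_def list_all2_Cons2)

text \<open>
  An element of \<open>rel_star n X R\<close> is the tuple of projections of any ultrafilter that contains
  \<open>R\<close> and all the products \<open>A\<^sub>1 \<times> \<dots> \<times> A\<^sub>n\<close> with \<open>A\<^sub>i \<in> \<uu>\<^sub>i\<close>.
\<close>

lemma rel_star_eq_projections:
  assumes "R \<subseteq> nlists n X"
  shows "rel_star n X R = {map (\<lambda>i. filtermap (\<lambda>xs. xs ! i) \<qq>) [0..<n] |\<qq>.
    \<qq> \<in> beta (nlists n X) \<and> (\<forall>\<^sub>F xs in \<qq>. xs \<in> R)}" (is "_ = ?E")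
proof (intro equalityI subsetI)
  fix us assume "us \<in> ?E"
  then obtain \<qq> where us: "us = map (\<lambda>i. filtermap (\<lambda>xs. xs ! i) \<qq>) [0..<n]"
    and \<qq>: "\<qq> \<in> beta (nlists n X)" "\<forall>\<^sub>F xs in \<qq>. xs \<in> R" by blast
  have "filtermap (\<lambda>xs. xs ! i) \<qq> \<in> beta X" if "i < n" for i
    by (rule filtermap_in_beta[OF \<qq>(1)]) (use that in \<open>auto intro: nlistsE_nth_in\<close>)
  then have "us \<in> nlists n (beta X)" by (auto simp: us in_nlists_iff)
  moreover have "R \<inter> listset As \<noteq> {}"
    if "list_all2 (\<lambda>A \<uu>. A \<subseteq> X \<and> (\<forall>\<^sub>F x in \<uu>. x \<in> A)) As us" for As
  proof -
    have As: "length As = n" "\<And>i. i < n \<Longrightarrow> \<forall>\<^sub>F xs in \<qq>. xs ! i \<in> As ! i"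
      using that by (auto simp: us list_all2_conv_all_nth eventually_filtermap)
    \<comment> \<open>There are finitely many coordinates, so the whole product belongs to
      \<open>\<qq>\<close> and meets \<open>R\<close>.\<close>
    have "\<forall>\<^sub>F xs in \<qq>. \<forall>i\<in>{..<n}. xs ! i \<in> As ! i"
      using As(2) by (intro eventually_ball_finite) auto
    with \<qq>(2) have "\<forall>\<^sub>F xs in \<qq>. xs \<in> R \<inter> listset As"
      by eventually_elim
        (use assms As(1) in \<open>auto simp: in_listset_iff list_all2_conv_all_nth in_nlists_iff\<close>)
    moreover have "\<qq> \<noteq> bot" using \<qq>(1) by (simp add: beta_def ultra_def)
    ultimately show ?thesis by (auto dest: eventually_happens')
  qed
  ultimately show "us \<in> rel_star n X R" by (simp add: rel_star_def)
next
  fix us assume us: "us \<in> rel_star n X R"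
  then have len: "length us = n" and beta: "\<And>i. i < n \<Longrightarrow> us ! i \<in> beta X"
    by (auto simp: rel_star_def in_nlists_iff)
  \<comment> \<open>Generated by \<open>R\<close> and the cylinders over members of the
    \<open>us ! i\<close>; it is proper because \<open>R\<close> meets every product of such
    members.\<close>
  define F where "F = inf (INF i\<in>{..<n}. filtercomap (\<lambda>xs. xs ! i) (us ! i)) (principal R)"
  have "F \<noteq> bot"
  proof
    assume "F = bot"
    then have "\<forall>\<^sub>F xs in (INF i\<in>{..<n}. filtercomap (\<lambda>xs. xs ! i) (us ! i)). xs \<notin> R"
      by (simp add: F_def trivial_limit_def eventually_inf_principal)
    then obtain Q where Q: "\<And>i. i < n \<Longrightarrow> eventually (Q i) (filtercomap (\<lambda>xs. xs ! i) (us ! i))"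
        "\<And>xs. (\<And>i. i < n \<Longrightarrow> Q i xs) \<Longrightarrow> xs \<notin> R"
      unfolding eventually_INF_finite[OF finite_lessThan] Ball_def lessThan_iff by blast
    then obtain P where P: "\<And>i. i < n \<Longrightarrow> eventually (P i) (us ! i)"
        "\<And>i xs. i < n \<Longrightarrow> P i (xs ! i) \<Longrightarrow> Q i xs"
      unfolding eventually_filtercomap by metis
    \<comment> \<open>The cylinder bases are cut down to \<open>X\<close>, as the definition of
      \<open>rel_star\<close> tests only subsets of \<open>X\<close>.\<close>
    define As where "As = map (\<lambda>i. {x \<in> X. P i x}) [0..<n]"
    have "list_all2 (\<lambda>A \<uu>. A \<subseteq> X \<and> (\<forall>\<^sub>F x in \<uu>. x \<in> A)) As us"
      using P(1) beta by (auto simp: As_def len list_all2_conv_all_nth beta_def eventually_conj_iff)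
    with us obtain xs where "xs \<in> R" "xs \<in> listset As" by (auto simp: rel_star_def)
    then have "\<And>i. i < n \<Longrightarrow> P i (xs ! i)"
      by (auto simp: in_listset_iff As_def list_all2_conv_all_nth)
    with P(2) Q(2) \<open>xs \<in> R\<close> show False by blast
  qed
  then obtain \<qq> where \<qq>: "ultra \<qq>" "\<qq> \<le> F" by (rule exists_ultra_le)
  from \<qq>(2) have R: "\<forall>\<^sub>F xs in \<qq>. xs \<in> R"
    by (simp add: F_def le_principal)
  then have "\<forall>\<^sub>F xs in \<qq>. xs \<in> nlists n X" by eventually_elim (use assms in blast)
  \<comment> \<open>The projection of \<open>\<qq>\<close> is proper and refines the ultrafilter
    \<open>us ! i\<close>, so the two coincide.\<close>
  moreover have "filtermap (\<lambda>xs. xs ! i) \<qq> = us ! i" if "i < n" for i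
  proof (rule ultra_le_eq)
    show "ultra (us ! i)" using beta[OF that] by (simp add: beta_def)
    have "\<qq> \<le> filtercomap (\<lambda>xs. xs ! i) (us ! i)"
      using \<qq>(2) that by (auto simp: F_def le_INF_iff)
    then show "filtermap (\<lambda>xs. xs ! i) \<qq> \<le> us ! i" by (simp add: filtermap_le_iff_le_filtercomap)
    show "filtermap (\<lambda>xs. xs ! i) \<qq> \<noteq> bot" using \<qq>(1) by (simp add: ultra_def filtermap_bot_iff)
  qed
  then have "us = map (\<lambda>i. filtermap (\<lambda>xs. xs ! i) \<qq>) [0..<n]"
    using len by (intro nth_equalityI) auto
  ultimately show "us \<in> ?E" using \<qq>(1) R by (auto simp: beta_def)
qed

lemma E_rel_eq:
  assumes "\<rr> \<in> beta (Pow (nlists n X))"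
  shows "E_rel n X \<rr> = rel_star n X (limit_rel n X \<rr>)"
  by (subst rel_star_eq_projections) (auto simp: E_rel_def e1_rel_eq[OF assms] limit_rel_def)

section \<open>Comparison with the extensions of ordinary operations and relations\<close>

lemma fun_tilde_pt:
  assumes "as \<in> nlists n X"
  shows "fun_tilde n X f (map pt as) = pt (f as)"
  by (rule filter_eqI) (simp add: eventually_fun_tilde[OF map_pt_in_nlists[OF assms]])

lemma fun_tilde_inj:
  assumes "f \<in> ops n X" "g \<in> ops n X" "fun_tilde n X f = fun_tilde n X g"
  shows "f = g"
  by (rule PiE_ext[OF assms(1,2)]) (metis assms(3) fun_tilde_pt pt_eq_iff)

lemma pt_in_rel_tilde_iff:
  assumes "as \<in> nlists n X"
  shows "map pt as \<in> rel_tilde n X Q \<longleftrightarrow> as \<in> Q"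
  by (simp add: rel_tilde_def map_pt_in_nlists[OF assms])

lemma rel_tilde_inj:
  assumes "Q \<subseteq> nlists n X" "Q' \<subseteq> nlists n X" "rel_tilde n X Q = rel_tilde n X Q'"
  shows "Q = Q'"
  using assms pt_in_rel_tilde_iff by blast

lemma pt_in_rel_star_iff:
  assumes "as \<in> nlists n X"
  shows "map pt as \<in> rel_star n X Q \<longleftrightarrow> as \<in> Q"
proof
  assume "map pt as \<in> rel_star n X Q"
  \<comment> \<open>Singletons serve as test sets; their product contains only
    \<open>as\<close>.\<close>
  moreover have "list_all2 (\<lambda>A \<uu>. A \<subseteq> X \<and> (\<forall>\<^sub>F x in \<uu>. x \<in> A)) (map (\<lambda>a. {a}) as) (map pt as)"
    using assms by (auto simp: list_all2_conv_all_nth in_nlists_iff)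
  ultimately obtain xs where "xs \<in> Q" "xs \<in> listset (map (\<lambda>a. {a}) as)"
    by (auto simp: rel_star_def)
  moreover from this(2) have "xs = as"
    by (auto simp: in_listset_iff list_all2_conv_all_nth intro: nth_equalityI)
  ultimately show "as \<in> Q" by simp
next
  assume "as \<in> Q"
  moreover have "as \<in> listset As"
    if "list_all2 (\<lambda>A \<uu>. A \<subseteq> X \<and> (\<forall>\<^sub>F x in \<uu>. x \<in> A)) As (map pt as)" for As
    using that by (auto simp: in_listset_iff list_all2_conv_all_nth)
  ultimately show "map pt as \<in> rel_star n X Q"
    by (auto simp: rel_star_def map_pt_in_nlists[OF assms])
qed

lemma rel_star_inj:
  assumes "Q \<subseteq> nlists n X" "Q' \<subseteq> nlists n X" "rel_star n X Q = rel_star n X Q'"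
  shows "Q = Q'"
  using assms pt_in_rel_star_iff by blast

lemma pseudo_principal_iff:
  assumes \<ff>: "\<ff> \<in> beta (ops n X)"
  shows "pseudo_principal n X \<ff> \<longleftrightarrow> (\<exists>f\<in>ops n X. e_fun n X \<ff> = fun_tilde n X f)"
proof
  assume "\<exists>f\<in>ops n X. e_fun n X \<ff> = fun_tilde n X f"
  then obtain f where f: "f \<in> ops n X" "e_fun n X \<ff> = fun_tilde n X f" by blast
  show "pseudo_principal n X \<ff>"
    unfolding pseudo_principal_def
  proof
    fix as assume as: "as \<in> nlists n X"
    have "app_tilde (map pt as) \<ff> = fun_tilde n X f (map pt as)"
      using map_pt_in_nlists[OF as] by (simp add: e_fun_eq[OF \<ff>] flip: f(2))
    also have "\<dots> = pt (f as)" by (rule fun_tilde_pt[OF as])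
    finally show "app_tilde (map pt as) \<ff> \<in> pt ` X" using f(1) as by auto
  qed
next
  assume "pseudo_principal n X \<ff>"
  then have "\<exists>x. x \<in> X \<and> app_tilde (map pt as) \<ff> = pt x" if "as \<in> nlists n X" for as
    using that by (auto simp: pseudo_principal_def)
  then obtain f where f: "\<And>as. as \<in> nlists n X \<Longrightarrow> f as \<in> X"
      "\<And>as. as \<in> nlists n X \<Longrightarrow> app_tilde (map pt as) \<ff> = pt (f as)"
    by metis
  \<comment> \<open>A principal value at \<open>as\<close> means that \<open>\<ff>\<close>-almost
    all \<open>h\<close> satisfy \<open>h as = f as\<close>; the quantifier over
    \<open>\<ff>\<close> can thus be removed under the quantifiers over the arguments.\<close>
  have ev: "(\<forall>\<^sub>F h in \<ff>. P (h as)) \<longleftrightarrow> P (f as)" if "as \<in> nlists n X" for as P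
    using eventually_app_tilde[of P "map pt as" \<ff>] f(2)[OF that] by simp
  have "app_tilde us \<ff> = fun_tilde n X (restrict f (nlists n X)) us"
    if us: "us \<in> nlists n (beta X)" for us
    by (rule filter_eqI, unfold eventually_app_tilde eventually_fun_tilde[OF us],
        rule eventuallys_cong_nlists[OF us]) (simp add: ev)
  then have "e_fun n X \<ff> = fun_tilde n X (restrict f (nlists n X))"
    unfolding e_fun_eq[OF \<ff>]
    by (intro extensionalityI[of _ "nlists n (beta X)"]) (auto simp: fun_tilde_def)
  with f(1) show "\<exists>f\<in>ops n X. e_fun n X \<ff> = fun_tilde n X f"
    by (intro bexI[of _ "restrict f (nlists n X)"]) auto
qed

section \<open>Reduction of both model equalities to one condition\<close>

lemma restrict_eq_restrict_iff: "restrict f A = restrict g A \<longleftrightarrow> (\<forall>x\<in>A. f x = g x)"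
  by (metis restrict_apply' restrict_ext)

text \<open>A common form of both equalities: they treat function symbols alike, and in each the
  relation is recovered from its extension by injectivity of \<open>rel_tilde\<close> or
  \<open>rel_star\<close>.\<close>

definition matches ::
  "('f, 'p) signature \<Rightarrow> 'a set \<Rightarrow> ('f, 'p, 'a) gen_model \<Rightarrow> ('f, 'p, 'a) model \<Rightarrow> bool" where
  "matches S X \<BB> \<AA> \<longleftrightarrow>
     (\<forall>s\<in>fun_syms S. e_fun (fun_arity S s) X (gfun_of \<BB> s) = fun_tilde (fun_arity S s) X (fun_of \<AA> s)) \<and>
     (\<forall>p\<in>rel_syms S. rel_of \<AA> p = limit_rel (rel_arity S p) X (grel_of \<BB> p))"

context
  fixes S :: "('f, 'p) signature" and X :: "'a set" and \<BB> :: "('f, 'p, 'a) gen_model"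
  assumes gen: "generalized_model S X \<BB>"
begin

lemma gen_model_in_beta:
  "s \<in> fun_syms S \<Longrightarrow> gfun_of \<BB> s \<in> beta (ops (fun_arity S s) X)"
  "p \<in> rel_syms S \<Longrightarrow> grel_of \<BB> p \<in> beta (Pow (nlists (rel_arity S p) X))"
  using gen by (auto simp: generalized_model_def)

lemma e_model_eq_iff:
  assumes \<AA>: "ordinary_model S X \<AA>"
  shows "e_model S \<BB> = tilde_model S \<AA> \<longleftrightarrow> matches S X \<BB> \<AA>"
proof -
  have "e_rel (rel_arity S p) X (grel_of \<BB> p) = rel_tilde (rel_arity S p) X (rel_of \<AA> p) \<longleftrightarrow>
      rel_of \<AA> p = limit_rel (rel_arity S p) X (grel_of \<BB> p)" if "p \<in> rel_syms S" for p
  proof -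
    have "rel_of \<AA> p \<subseteq> nlists (rel_arity S p) X"
      using \<AA> that by (auto simp: ordinary_model_def)
    moreover have "limit_rel (rel_arity S p) X (grel_of \<BB> p) \<subseteq> nlists (rel_arity S p) X"
      by (auto simp: limit_rel_def)
    ultimately show ?thesis
      using rel_tilde_inj unfolding e_rel_eq[OF gen_model_in_beta(2)[OF that]] by metis
  qed
  then show ?thesis
    using gen \<AA>
    by (simp add: matches_def e_model_def tilde_model_def restrict_eq_restrict_iff
        generalized_model_def ordinary_model_def)
qed

lemma E_model_eq_iff:
  assumes \<AA>: "ordinary_model S X \<AA>"
  shows "E_model S \<BB> = star_model S \<AA> \<longleftrightarrow> matches S X \<BB> \<AA>"
proof -
  have "E_rel (rel_arity S p) X (grel_of \<BB> p) = rel_star (rel_arity S p) X (rel_of \<AA> p) \<longleftrightarrow>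
      rel_of \<AA> p = limit_rel (rel_arity S p) X (grel_of \<BB> p)" if "p \<in> rel_syms S" for p
  proof -
    have "rel_of \<AA> p \<subseteq> nlists (rel_arity S p) X"
      using \<AA> that by (auto simp: ordinary_model_def)
    moreover have "limit_rel (rel_arity S p) X (grel_of \<BB> p) \<subseteq> nlists (rel_arity S p) X"
      by (auto simp: limit_rel_def)
    ultimately show ?thesis
      using rel_star_inj unfolding E_rel_eq[OF gen_model_in_beta(2)[OF that]] by metis
  qed
  then show ?thesis
    using gen \<AA>
    by (simp add: matches_def E_model_def star_model_def E_fun_def restrict_eq_restrict_iff
        generalized_model_def ordinary_model_def)
qed

text \<open>Only function symbols impose a condition, settled one by one by
  \<open>pseudo_principal_iff\<close>; relations are taken to be the limit relations.\<close>

lemma ex_matches_iff: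
  "(\<exists>\<AA>. ordinary_model S X \<AA> \<and> matches S X \<BB> \<AA>) \<longleftrightarrow> pseudo_principal_on_funs S \<BB>"
proof
  assume "\<exists>\<AA>. ordinary_model S X \<AA> \<and> matches S X \<BB> \<AA>"
  then obtain \<AA> where \<AA>: "ordinary_model S X \<AA>" "matches S X \<BB> \<AA>" by blast
  have "pseudo_principal (fun_arity S s) X (gfun_of \<BB> s)" if s: "s \<in> fun_syms S" for s
    unfolding pseudo_principal_iff[OF gen_model_in_beta(1)[OF s]]
    using \<AA> s by (intro bexI[of _ "fun_of \<AA> s"]) (auto simp: matches_def ordinary_model_def)
  then show "pseudo_principal_on_funs S \<BB>"
    using gen by (simp add: pseudo_principal_on_funs_def generalized_model_def)
next
  assume "pseudo_principal_on_funs S \<BB>"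
  then have "\<exists>f. f \<in> ops (fun_arity S s) X \<and>
      e_fun (fun_arity S s) X (gfun_of \<BB> s) = fun_tilde (fun_arity S s) X f" if "s \<in> fun_syms S" for s
    using that gen pseudo_principal_iff[OF gen_model_in_beta(1)[OF that]]
    by (auto simp: pseudo_principal_on_funs_def generalized_model_def)
  then obtain f where f: "\<And>s. s \<in> fun_syms S \<Longrightarrow> f s \<in> ops (fun_arity S s) X"
      "\<And>s. s \<in> fun_syms S \<Longrightarrow>
        e_fun (fun_arity S s) X (gfun_of \<BB> s) = fun_tilde (fun_arity S s) X (f s)"
    by metis
  let ?\<AA> = "\<lparr>universe = X, fun_of = restrict f (fun_syms S),
    rel_of = (\<lambda>p\<in>rel_syms S. limit_rel (rel_arity S p) X (grel_of \<BB> p))\<rparr>"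
  have "ordinary_model S X ?\<AA>"
    unfolding ordinary_model_def using f(1) by (simp add: limit_rel_def PiE_iff)
  moreover have "matches S X \<BB> ?\<AA>"
    using f(2) by (simp add: matches_def)
  ultimately show "\<exists>\<AA>. ordinary_model S X \<AA> \<and> matches S X \<BB> \<AA>" by blast
qed

lemma matches_unique:
  assumes \<AA>: "ordinary_model S X \<AA>" "matches S X \<BB> \<AA>"
    and \<AA>': "ordinary_model S X \<AA>'" "matches S X \<BB> \<AA>'"
  shows "\<AA> = \<AA>'"
proof (rule model.equality)
  show "fun_of \<AA> = fun_of \<AA>'"
  proof (rule PiE_ext[where k = "fun_syms S" and s = "\<lambda>s. ops (fun_arity S s) X"])
    fix s assume s: "s \<in> fun_syms S"
    show "fun_of \<AA> s = fun_of \<AA>' s"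
      by (rule fun_tilde_inj[where n = "fun_arity S s" and X = X])
        (use \<AA> \<AA>' s in \<open>auto simp: matches_def ordinary_model_def\<close>)
  qed (use \<AA>(1) \<AA>'(1) in \<open>simp_all add: ordinary_model_def\<close>)
  show "rel_of \<AA> = rel_of \<AA>'"
    by (rule PiE_ext[where k = "rel_syms S" and s = "\<lambda>p. Pow (nlists (rel_arity S p) X)"])
      (use \<AA> \<AA>' in \<open>auto simp: matches_def ordinary_model_def\<close>)
qed (use \<AA>(1) \<AA>'(1) in \<open>simp_all add: ordinary_model_def\<close>)

end

theorem theorem28:
  fixes S :: "('f, 'p) signature" and X :: "'a set" and \<BB> :: "('f, 'p, 'a) gen_model"
  assumes "generalized_model S X \<BB>"
  shows "((\<exists>\<AA>. ordinary_model S X \<AA> \<and> e_model S \<BB> = tilde_model S \<AA>) \<longleftrightarrow>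
           (\<exists>\<AA>. ordinary_model S X \<AA> \<and> E_model S \<BB> = star_model S \<AA>)) \<and>
         ((\<exists>\<AA>. ordinary_model S X \<AA> \<and> E_model S \<BB> = star_model S \<AA>) \<longleftrightarrow>
           pseudo_principal_on_funs S \<BB>) \<and>
         (\<forall>\<AA> \<AA>'. ordinary_model S X \<AA> \<and> ordinary_model S X \<AA>' \<and>
           e_model S \<BB> = tilde_model S \<AA> \<and> E_model S \<BB> = star_model S \<AA>' \<longrightarrow> \<AA> = \<AA>')"
  \<comment> \<open>Both existence claims become existence of a matching model, and any two models
    realising the two equalities match \<open>\<BB>\<close>, hence coincide.\<close>
  using ex_matches_iff[OF assms] matches_unique[OF assms] e_model_eq_iff[OF assms]
    E_model_eq_iff[OF assms]
  by (auto cong: conj_cong)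

end
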